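(* Let $1<p<\infty$, let $m$ be a positive integer and let $a_1,\dots,a_m$ be real numbers. Define $Q_m:l_p\times l_p\to l_p$ by $$Q_m(x,y)=\left\{\sum_{i=1}^ma_i(t_n^2+s_n)^i\right\}_{n=1}^\infty\quad\text{for } x=\{t_n\}_{n=1}^\infty,\ y=\{s_n\}_{n=1}^\infty\in l_p.$$ Then $Q_m$ is partially Gâteaux differentiable on $l_p\times l_p$ with respect to each variable, and for any $(\bar x,\bar y)\in l_p\times l_p$ with $\bar x=(\bar t_1,\bar t_2,\dots)$ and $\bar y=(\bar s_1,\bar s_2,\dots)$: (i) for any $v=\{t_n\}_{n=1}^\infty\in l_p\setminus\{\theta\}$, $$\partial_1Q_m(\bar x,\bar y)(v)=\nabla_1(Q_m)(\bar x,\bar y)(v)=2\left\{\sum_{i=1}^ma_i\,i\,\bar t_n(\bar t_n^2+\bar s_n)^{i-1}t_n\right\}_{n=1}^\infty\in l_p;$$ (ii) for any $u=\{s_n\}_{n=1}^\infty\in l_p\setminus\{\theta\}$, $$\partial_2Q_m(\bar x,\bar y)(u)=\nabla_2(Q_m)(\bar x,\bar y)(u)=\left\{\sum_{i=1}^mi\,a_i(\bar t_n^2+\bar s_n)^{i-1}s_n\right\}_{n=1}^\infty\in l_p.$$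
   Context: $l_p$ is the real sequence space with norm $\|\cdot\|_p$ and null element $\theta=(0,0,\dots)$. For $i=1$ the expression $(\cdot)^{i-1}$ equals $1$. $F:l_p\times l_p\to l_p$ is partially Gâteaux differentiable with respect to the first (second) variable at $(\bar x,\bar y)$ if for every $v\in l_p\setminus\{\theta\}$ the limit over real $t$, $\partial_1F(\bar x,\bar y)(v)=\lim_{t\to0}\frac{F(\bar x+tv,\bar y)-F(\bar x,\bar y)}{t}$ ($\partial_2F(\bar x,\bar y)(v)=\lim_{t\to0}\frac{F(\bar x,\bar y+tv)-F(\bar x,\bar y)}{t}$), exists in $l_p$. The partial Fréchet derivatives $\nabla_1F(\bar x,\bar y),\nabla_2F(\bar x,\bar y)$ are the continuous linear mappings $l_p\to l_p$ with $\lim_{u\to\theta}\frac{F(\bar x+u,\bar y)-F(\bar x,\bar y)-\nabla_1F(\bar x,\bar y)(u)}{\|u\|_p}=\theta$ and $\lim_{w\to\theta}\frac{F(\bar x,\bar y+w)-F(\bar x,\bar y)-\nabla_2F(\bar x,\bar y)(w)}{\|w\|_p}=\theta$. *)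

theory Defs
  imports "HOL-Analysis.Analysis" "HOL-Library.Function_Algebras"
begin

text \<open>
  Real sequences are functions \<^typ>\<open>nat \<Rightarrow> real\<close> (so indexing starts at \<open>0\<close>) with the pointwise
  operations of \<^theory>\<open>HOL-Library.Function_Algebras\<close>; in particular \<open>0\<close> is the null sequence
  \<open>\<theta>\<close>. Since the exponent \<open>p\<close> is a variable, \<open>l\<^sub>p\<close> is a carrier set, and it carries the topology
  of its norm. This is \<^emph>\<open>not\<close> the product topology that the type class instance for functions
  puts on \<^typ>\<open>nat \<Rightarrow> real\<close>.
\<close>

definition lp :: "real \<Rightarrow> (nat \<Rightarrow> real) set" where
  "lp p = {x. summable (\<lambda>n. \<bar>x n\<bar> powr p)}"

definition lp_norm :: "real \<Rightarrow> (nat \<Rightarrow> real) \<Rightarrow> real" where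
  "lp_norm p x = (\<Sum>n. \<bar>x n\<bar> powr p) powr (1 / p)"

definition lp_dist :: "real \<Rightarrow> (nat \<Rightarrow> real) \<Rightarrow> (nat \<Rightarrow> real) \<Rightarrow> real" where
  "lp_dist p x y = lp_norm p (x - y)"

definition lp_topology :: "real \<Rightarrow> (nat \<Rightarrow> real) topology" where
  "lp_topology p = Metric_space.mtopology (lp p) (lp_dist p)"

lemma lp_norm_nonneg: "0 \<le> lp_norm p x"
  by (simp add: lp_norm_def)

lemma lp_norm_powr:
  assumes "1 \<le> p" "x \<in> lp p"
  shows "lp_norm p x powr p = (\<Sum>n. \<bar>x n\<bar> powr p)"
  using assms by (simp add: lp_norm_def lp_def powr_powr suminf_nonneg)

lemma lp_norm_eq_0:
  assumes "1 \<le> p" "x \<in> lp p"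
  shows "lp_norm p x = 0 \<longleftrightarrow> x = 0"
proof
  assume "lp_norm p x = 0"
  then have "(\<Sum>n. \<bar>x n\<bar> powr p) = 0"
    by (simp add: lp_norm_def)
  then have "\<bar>x n\<bar> powr p = 0" for n
    using assms suminf_eq_zero_iff[of "\<lambda>n. \<bar>x n\<bar> powr p"] by (simp add: lp_def)
  then show "x = 0"
    by (auto simp: fun_eq_iff)
qed (use assms in \<open>simp add: lp_norm_def\<close>)

lemma powr_convex_nonneg:
  fixes a b p u :: real
  assumes p: "1 \<le> p" and a: "0 \<le> a" and b: "0 \<le> b" and u: "0 < u" "u < 1"
  shows "(u * a + (1 - u) * b) powr p \<le> u * a powr p + (1 - u) * b powr p"
proof -
  have scale: "(w * c) powr p \<le> w * c powr p" if "0 < w" "w < 1" "0 \<le> c" for w c :: real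
  proof -
    have "w powr p \<le> w powr 1"
      using that p by (intro powr_mono') auto
    then have "w powr p * c powr p \<le> w * c powr p"
      using that by (intro mult_right_mono) auto
    then show ?thesis
      using that by (simp add: powr_mult)
  qed
  consider "a = 0" | "b = 0" | "0 < a" "0 < b"
    using a b by linarith
  then show ?thesis
  proof cases
    case 1
    then show ?thesis using scale[of "1 - u" b] u b by simp
  next
    case 2
    then show ?thesis using scale[of u a] u a by simp
  next
    case 3
    then show ?thesis
      using convex_onD[OF powr_convex[OF p], of "1 - u" a b] u by simp
  qed
qed

lemma lp_uminus: "x \<in> lp p \<Longrightarrow> - x \<in> lp p"
  by (simp add: lp_def)

lemma lp_minkowski:
  assumes p: "1 \<le> p" and x: "x \<in> lp p" and y: "y \<in> lp p"
  shows "x + y \<in> lp p" and "lp_norm p (x + y) \<le> lp_norm p x + lp_norm p y"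
proof -
  define A B where "A = lp_norm p x" and "B = lp_norm p y"
  have "x + y \<in> lp p \<and> lp_norm p (x + y) \<le> A + B"
  proof (cases "A = 0 \<or> B = 0")
    case True
    then have "x = 0 \<or> y = 0"
      using lp_norm_eq_0[OF p] x y by (auto simp: A_def B_def)
    then show ?thesis
      using x y lp_norm_nonneg by (auto simp: A_def B_def)
  next
    case False
    then have A: "0 < A" and B: "0 < B"
      using lp_norm_nonneg[of p x] lp_norm_nonneg[of p y] by (auto simp: A_def B_def)
    define u where "u = A / (A + B)"
    have u: "0 < u" "u < 1" and u1: "1 - u = B / (A + B)"
      using A B by (auto simp: u_def field_simps)
    define g where "g n = (A + B) powr p *
      (u * (\<bar>x n\<bar> powr p / A powr p) + (1 - u) * (\<bar>y n\<bar> powr p / B powr p))" for n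
    have le: "\<bar>x n + y n\<bar> powr p \<le> g n" for n
    proof -
      have eq: "\<bar>x n\<bar> + \<bar>y n\<bar> = (A + B) * (u * (\<bar>x n\<bar> / A) + (1 - u) * (\<bar>y n\<bar> / B))"
      proof -
        have "(A + B) * u = A" "(A + B) * (1 - u) = B"
          using A B unfolding u1 by (simp_all add: u_def)
        then show ?thesis
          using A B by (simp only: distrib_left mult.assoc[symmetric]) simp
      qed
      have "\<bar>x n + y n\<bar> powr p \<le> (\<bar>x n\<bar> + \<bar>y n\<bar>) powr p"
        using p by (intro powr_mono2) auto
      also have "\<dots> = (A + B) powr p * (u * (\<bar>x n\<bar> / A) + (1 - u) * (\<bar>y n\<bar> / B)) powr p"
        using A B u by (subst eq, subst powr_mult) auto
      also have "\<dots> \<le> (A + B) powr p *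
          (u * (\<bar>x n\<bar> / A) powr p + (1 - u) * (\<bar>y n\<bar> / B) powr p)"
        using A B u p by (intro mult_left_mono powr_convex_nonneg) auto
      also have "\<dots> = g n"
        using A B by (simp add: g_def powr_divide)
      finally show ?thesis .
    qed
    have sx: "(\<lambda>n. \<bar>x n\<bar> powr p) sums (A powr p)" and sy: "(\<lambda>n. \<bar>y n\<bar> powr p) sums (B powr p)"
      using lp_norm_powr[OF p] x y by (auto simp: A_def B_def lp_def summable_sums)
    have "g sums ((A + B) powr p * (u * (A powr p / A powr p) + (1 - u) * (B powr p / B powr p)))"
      unfolding g_def by (intro sums_mult sums_add sums_divide sx sy)
    then have g: "g sums ((A + B) powr p)"
      using A B by simp
    have sm: "summable (\<lambda>n. \<bar>x n + y n\<bar> powr p)"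
      by (rule summable_comparison_test'[OF sums_summable[OF g], of 0]) (use le in auto)
    have "(\<Sum>n. \<bar>x n + y n\<bar> powr p) \<le> (A + B) powr p"
      using suminf_le[OF le sm sums_summable[OF g]] sums_unique[OF g] by simp
    then have "(\<Sum>n. \<bar>x n + y n\<bar> powr p) powr (1 / p) \<le> ((A + B) powr p) powr (1 / p)"
      using p sm by (intro powr_mono2 suminf_nonneg) auto
    also have "\<dots> = A + B"
      using p A B by (simp add: powr_powr)
    finally show ?thesis
      using sm by (simp add: lp_def lp_norm_def)
  qed
  then show "x + y \<in> lp p" "lp_norm p (x + y) \<le> lp_norm p x + lp_norm p y"
    by (auto simp: A_def B_def)
qed

lemma Metric_space_lp:
  assumes "1 \<le> p"
  shows "Metric_space (lp p) (lp_dist p)"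
proof
  show "0 \<le> lp_dist p x y" for x y
    by (simp add: lp_dist_def lp_norm_nonneg)
  show "lp_dist p x y = lp_dist p y x" for x y
    by (simp add: lp_dist_def lp_norm_def abs_minus_commute)
  have diff: "x - y \<in> lp p" if "x \<in> lp p" "y \<in> lp p" for x y
    using lp_minkowski(1)[OF assms that(1) lp_uminus[OF that(2)]] by simp
  show "lp_dist p x y = 0 \<longleftrightarrow> x = y" if "x \<in> lp p" "y \<in> lp p" for x y
    using lp_norm_eq_0[OF assms diff[OF that]] by (simp add: lp_dist_def)
  show "lp_dist p x z \<le> lp_dist p x y + lp_dist p y z"
    if "x \<in> lp p" "y \<in> lp p" "z \<in> lp p" for x y z
    using lp_minkowski(2)[OF assms diff[OF that(1,2)] diff[OF that(2,3)]]
    by (simp add: lp_dist_def)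
qed

lemma topspace_lp_topology: "1 \<le> p \<Longrightarrow> topspace (lp_topology p) = lp p"
  by (simp add: lp_topology_def Metric_space.topspace_mtopology Metric_space_lp)

text \<open>
  Derivatives of a map \<open>G : l\<^sub>p \<rightarrow> l\<^sub>p\<close> at \<open>z\<close>. Limits are taken in \<^const>\<open>lp_topology\<close>, so
  \<^const>\<open>limitin\<close> also forces the limit to lie in \<open>l\<^sub>p\<close>.
\<close>

definition has_gateaux_derivative ::
  "real \<Rightarrow> ((nat \<Rightarrow> real) \<Rightarrow> nat \<Rightarrow> real) \<Rightarrow> (nat \<Rightarrow> real) \<Rightarrow> (nat \<Rightarrow> real) \<Rightarrow> (nat \<Rightarrow> real) \<Rightarrow> bool" where
  "has_gateaux_derivative p G z v d \<longleftrightarrow>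
     limitin (lp_topology p) (\<lambda>t n. (G (z + (\<lambda>k. t * v k)) n - G z n) / t) d (at (0::real))"

definition gateaux_differentiable ::
  "real \<Rightarrow> ((nat \<Rightarrow> real) \<Rightarrow> nat \<Rightarrow> real) \<Rightarrow> (nat \<Rightarrow> real) \<Rightarrow> bool" where
  "gateaux_differentiable p G z \<longleftrightarrow>
     (\<forall>v \<in> lp p - {0}. \<exists>d. has_gateaux_derivative p G z v d)"

definition gateaux_derivative ::
  "real \<Rightarrow> ((nat \<Rightarrow> real) \<Rightarrow> nat \<Rightarrow> real) \<Rightarrow> (nat \<Rightarrow> real) \<Rightarrow> (nat \<Rightarrow> real) \<Rightarrow> nat \<Rightarrow> real" where
  "gateaux_derivative p G z v = (THE d. has_gateaux_derivative p G z v d)"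

definition lp_continuous_linear :: "real \<Rightarrow> ((nat \<Rightarrow> real) \<Rightarrow> nat \<Rightarrow> real) \<Rightarrow> bool" where
  "lp_continuous_linear p D \<longleftrightarrow>
     (\<forall>u \<in> lp p. \<forall>v \<in> lp p. D (u + v) = D u + D v) \<and>
     (\<forall>c. \<forall>u \<in> lp p. D (\<lambda>n. c * u n) = (\<lambda>n. c * D u n)) \<and>
     continuous_map (lp_topology p) (lp_topology p) D"

definition has_frechet_derivative ::
  "real \<Rightarrow> ((nat \<Rightarrow> real) \<Rightarrow> nat \<Rightarrow> real) \<Rightarrow> (nat \<Rightarrow> real) \<Rightarrow> ((nat \<Rightarrow> real) \<Rightarrow> nat \<Rightarrow> real) \<Rightarrow> bool" where
  "has_frechet_derivative p G z D \<longleftrightarrow>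
     lp_continuous_linear p D \<and>
     limitin (lp_topology p) (\<lambda>u n. (G (z + u) n - G z n - D u n) / lp_norm p u) 0
       (atin (lp_topology p) 0)"

definition frechet_differentiable ::
  "real \<Rightarrow> ((nat \<Rightarrow> real) \<Rightarrow> nat \<Rightarrow> real) \<Rightarrow> (nat \<Rightarrow> real) \<Rightarrow> bool" where
  "frechet_differentiable p G z \<longleftrightarrow> (\<exists>D. has_frechet_derivative p G z D)"

text \<open>
  A Frechet derivative is determined on \<open>l\<^sub>p\<close> only: as a function on all sequences it is
  arbitrary off the carrier, hence \<open>SOME\<close> rather than \<open>THE\<close>.
\<close>

definition lp_frechet_derivative ::
  "real \<Rightarrow> ((nat \<Rightarrow> real) \<Rightarrow> nat \<Rightarrow> real) \<Rightarrow> (nat \<Rightarrow> real) \<Rightarrow> (nat \<Rightarrow> real) \<Rightarrow> nat \<Rightarrow> real" where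
  "lp_frechet_derivative p G z = (SOME D. has_frechet_derivative p G z D)"

type_synonym lp_map2 = "(nat \<Rightarrow> real) \<Rightarrow> (nat \<Rightarrow> real) \<Rightarrow> nat \<Rightarrow> real"

definition partial1_gateaux_differentiable ::
  "real \<Rightarrow> lp_map2 \<Rightarrow> (nat \<Rightarrow> real) \<Rightarrow> (nat \<Rightarrow> real) \<Rightarrow> bool" where
  "partial1_gateaux_differentiable p F x y \<longleftrightarrow> gateaux_differentiable p (\<lambda>z. F z y) x"

definition partial2_gateaux_differentiable ::
  "real \<Rightarrow> lp_map2 \<Rightarrow> (nat \<Rightarrow> real) \<Rightarrow> (nat \<Rightarrow> real) \<Rightarrow> bool" where
  "partial2_gateaux_differentiable p F x y \<longleftrightarrow> gateaux_differentiable p (\<lambda>z. F x z) y"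

definition partial1_gateaux ::
  "real \<Rightarrow> lp_map2 \<Rightarrow> (nat \<Rightarrow> real) \<Rightarrow> (nat \<Rightarrow> real) \<Rightarrow> (nat \<Rightarrow> real) \<Rightarrow> nat \<Rightarrow> real" where
  "partial1_gateaux p F x y = gateaux_derivative p (\<lambda>z. F z y) x"

definition partial2_gateaux ::
  "real \<Rightarrow> lp_map2 \<Rightarrow> (nat \<Rightarrow> real) \<Rightarrow> (nat \<Rightarrow> real) \<Rightarrow> (nat \<Rightarrow> real) \<Rightarrow> nat \<Rightarrow> real" where
  "partial2_gateaux p F x y = gateaux_derivative p (\<lambda>z. F x z) y"

definition partial1_frechet_differentiable ::
  "real \<Rightarrow> lp_map2 \<Rightarrow> (nat \<Rightarrow> real) \<Rightarrow> (nat \<Rightarrow> real) \<Rightarrow> bool" where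
  "partial1_frechet_differentiable p F x y \<longleftrightarrow> frechet_differentiable p (\<lambda>z. F z y) x"

definition partial2_frechet_differentiable ::
  "real \<Rightarrow> lp_map2 \<Rightarrow> (nat \<Rightarrow> real) \<Rightarrow> (nat \<Rightarrow> real) \<Rightarrow> bool" where
  "partial2_frechet_differentiable p F x y \<longleftrightarrow> frechet_differentiable p (\<lambda>z. F x z) y"

definition partial1_frechet ::
  "real \<Rightarrow> lp_map2 \<Rightarrow> (nat \<Rightarrow> real) \<Rightarrow> (nat \<Rightarrow> real) \<Rightarrow> (nat \<Rightarrow> real) \<Rightarrow> nat \<Rightarrow> real" where
  "partial1_frechet p F x y = lp_frechet_derivative p (\<lambda>z. F z y) x"

definition partial2_frechet ::
  "real \<Rightarrow> lp_map2 \<Rightarrow> (nat \<Rightarrow> real) \<Rightarrow> (nat \<Rightarrow> real) \<Rightarrow> (nat \<Rightarrow> real) \<Rightarrow> nat \<Rightarrow> real" where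
  "partial2_frechet p F x y = lp_frechet_derivative p (\<lambda>z. F x z) y"

definition Q :: "nat \<Rightarrow> (nat \<Rightarrow> real) \<Rightarrow> lp_map2" where
  "Q m a x y = (\<lambda>n. \<Sum>i=1..m. a i * ((x n)\<^sup>2 + y n) ^ i)"

end

theory Submission
  imports Defs
begin

text \<open>
  \<open>Q\<^sub>m\<close> acts coordinatewise: with one variable fixed it is a superposition operator
  \<open>z \<mapsto> (g\<^sub>n(z\<^sub>n))\<^sub>n\<close>, where \<open>g\<^sub>n(h) = P(h\<^sup>2 + s\<^sub>n)\<close> or \<open>g\<^sub>n(h) = P(t\<^sub>n\<^sup>2 + h)\<close> and
  \<open>P(w) = \<Sum>a\<^sub>iw\<^sup>i\<close>. A coordinate of an \<open>l\<^sub>p\<close> sequence is at most the norm of the sequence, so near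
  a given point all arguments of \<open>P\<close> lie in one interval \<open>[-R, R]\<close>. There \<open>P'\<close> is bounded and the
  first-order Taylor remainder of \<open>P\<close> is at most \<open>C k\<^sup>2\<close> (\<open>power_sum_remainder\<close>), so the functions
  \<open>g\<^sub>n\<close> have bounded derivatives \<open>c\<^sub>n\<close> at \<open>z\<^sub>n\<close> and quadratic remainders with a constant that does
  not depend on \<open>n\<close>.

  This uniformity gives the derivative (\<open>superposition_has_frechet_derivative\<close>): the
  remainder for the increment \<open>u\<close> is dominated coordinatewise by
  \<open>C \<bar>u\<^sub>n\<bar>\<^sup>2 \<le> C \<parallel>u\<parallel> \<bar>u\<^sub>n\<bar>\<close>, so its norm is at most \<open>C \<parallel>u\<parallel>\<^sup>2\<close>, and multiplication by the bounded
  sequence \<open>c\<close> is a continuous linear map. The Gateaux statements are then consequences of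
  Frechet differentiability (\<open>frechet_imp_gateaux\<close>), and uniqueness of limits identifies
  the values of both derivatives with \<open>c\<^sub>n u\<^sub>n\<close>.
\<close>

section \<open>Domination in sequence spaces\<close>

lemma lp_coord_le_norm:
  assumes p: "1 \<le> p" and x: "x \<in> lp p"
  shows "\<bar>x n\<bar> \<le> lp_norm p x"
proof -
  have "\<bar>x n\<bar> powr p \<le> (\<Sum>k. \<bar>x k\<bar> powr p)"
    using x sum_le_suminf[of "\<lambda>k. \<bar>x k\<bar> powr p" "{n}"] by (simp add: lp_def)
  then have "(\<bar>x n\<bar> powr p) powr (1 / p) \<le> lp_norm p x"
    unfolding lp_norm_def using p by (intro powr_mono2) auto
  then show ?thesis
    using p by (simp add: powr_powr)
qed

lemma lp_scale:
  assumes p: "1 \<le> p" and x: "x \<in> lp p"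
  shows "(\<lambda>n. c * x n) \<in> lp p" and "lp_norm p (\<lambda>n. c * x n) = \<bar>c\<bar> * lp_norm p x"
proof -
  have sm: "summable (\<lambda>n. \<bar>x n\<bar> powr p)"
    using x by (simp add: lp_def)
  have eq: "\<bar>c * x n\<bar> powr p = \<bar>c\<bar> powr p * \<bar>x n\<bar> powr p" for n
    by (simp add: abs_mult powr_mult)
  show "(\<lambda>n. c * x n) \<in> lp p"
    using sm by (simp add: lp_def eq summable_mult)
  have "(\<Sum>n. \<bar>c * x n\<bar> powr p) = \<bar>c\<bar> powr p * (\<Sum>n. \<bar>x n\<bar> powr p)"
    unfolding eq by (rule suminf_mult[OF sm])
  then show "lp_norm p (\<lambda>n. c * x n) = \<bar>c\<bar> * lp_norm p x"
    using p sm by (simp add: lp_norm_def powr_mult powr_powr suminf_nonneg)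
qed

lemma lp_dominated:
  assumes p: "1 \<le> p" and x: "x \<in> lp p" and le: "\<And>n. \<bar>z n\<bar> \<le> C * \<bar>x n\<bar>" and C: "0 \<le> C"
  shows "z \<in> lp p" and "lp_norm p z \<le> C * lp_norm p x"
proof -
  have Cx: "(\<lambda>n. C * x n) \<in> lp p"
    using lp_scale[OF p x] by blast
  have pw: "\<bar>z n\<bar> powr p \<le> \<bar>C * x n\<bar> powr p" for n
    using le[of n] p C by (intro powr_mono2) (auto simp: abs_mult)
  have sm: "summable (\<lambda>n. \<bar>z n\<bar> powr p)"
    by (rule summable_comparison_test'[where g = "\<lambda>n. \<bar>C * x n\<bar> powr p" and N = 0])
      (use Cx pw in \<open>auto simp: lp_def\<close>)
  then show "z \<in> lp p"
    by (simp add: lp_def)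
  have "(\<Sum>n. \<bar>z n\<bar> powr p) \<le> (\<Sum>n. \<bar>C * x n\<bar> powr p)"
    using Cx by (intro suminf_le pw sm) (simp add: lp_def)
  then have "lp_norm p z \<le> lp_norm p (\<lambda>n. C * x n)"
    unfolding lp_norm_def using p sm by (intro powr_mono2 suminf_nonneg) auto
  then show "lp_norm p z \<le> C * lp_norm p x"
    using lp_scale[OF p x] C by simp
qed

lemma lp_diff:
  assumes "1 \<le> p" "x \<in> lp p" "y \<in> lp p"
  shows "x - y \<in> lp p"
  using lp_minkowski(1)[OF assms(1,2) lp_uminus[OF assms(3)]] by simp

lemma zero_in_lp: "0 \<in> lp p"
  by (simp add: lp_def)

section \<open>Frechet and Gateaux derivatives\<close>

lemma limitin_lp:
  assumes "1 \<le> p"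
  shows "limitin (lp_topology p) f l F \<longleftrightarrow>
    l \<in> lp p \<and> (\<forall>\<epsilon>>0. \<forall>\<^sub>F x in F. f x \<in> lp p \<and> lp_norm p (f x - l) < \<epsilon>)"
  unfolding lp_topology_def Metric_space.limitin_metric[OF Metric_space_lp[OF assms]] lp_dist_def ..

lemma limitin_lp_atin_zero:
  assumes p: "1 \<le> p"
  shows "limitin (lp_topology p) f 0 (atin (lp_topology p) 0) \<longleftrightarrow>
    (\<forall>\<epsilon>>0. \<exists>\<delta>>0. \<forall>u \<in> lp p. 0 < lp_norm p u \<and> lp_norm p u < \<delta> \<longrightarrow>
       f u \<in> lp p \<and> lp_norm p (f u) < \<epsilon>)"
  unfolding limitin_lp[OF p]
  unfolding lp_topology_def Metric_space.eventually_atin_metric[OF Metric_space_lp[OF p]] lp_dist_def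
  by (simp add: zero_in_lp Ball_def imp_conjL)

lemma gateaux_derivative_eq:
  assumes p: "1 \<le> p" and d: "has_gateaux_derivative p G z v d"
  shows "gateaux_derivative p G z v = d"
  unfolding gateaux_derivative_def
proof (rule the_equality)
  fix d' assume "has_gateaux_derivative p G z v d'"
  from this[unfolded has_gateaux_derivative_def lp_topology_def]
    d[unfolded has_gateaux_derivative_def lp_topology_def] at_neq_bot
  show "d' = d"
    by (rule Metric_space.limitin_metric_unique[OF Metric_space_lp[OF p]])
qed (rule d)

text \<open>
  Restricting the Frechet limit to increments \<open>u = t v\<close>: the Gateaux error at \<open>t\<close> is, up to sign,
  \<open>\<parallel>v\<parallel>\<close> times the Frechet quotient at \<open>t v\<close>.
\<close>

lemma frechet_imp_gateaux:
  assumes p: "1 \<le> p" and D: "has_frechet_derivative p G z D" and v: "v \<in> lp p" "v \<noteq> 0"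
  shows "has_gateaux_derivative p G z v (D v)"
proof -
  define q where "q u = (\<lambda>n. (G (z + u) n - G z n - D u n) / lp_norm p u)" for u
  define N where "N = lp_norm p v"
  have N: "0 < N"
    using lp_norm_eq_0[OF p v(1)] lp_norm_nonneg[of p v] v(2) by (simp add: N_def less_le)
  have Dv: "D v \<in> lp p"
    using D v(1) continuous_map_image_subset_topspace[of "lp_topology p" "lp_topology p" D]
    by (auto simp: has_frechet_derivative_def lp_continuous_linear_def topspace_lp_topology[OF p])
  have Dt: "D (\<lambda>k. t * v k) = (\<lambda>n. t * D v n)" for t
    using D v(1) by (simp add: has_frechet_derivative_def lp_continuous_linear_def)
  have lim: "limitin (lp_topology p) q 0 (atin (lp_topology p) 0)"
    using D by (simp add: has_frechet_derivative_def q_def[abs_def])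
  have "\<forall>\<^sub>F t in at 0. (\<lambda>n. (G (z + (\<lambda>k. t * v k)) n - G z n) / t) \<in> lp p \<and>
      lp_norm p ((\<lambda>n. (G (z + (\<lambda>k. t * v k)) n - G z n) / t) - D v) < \<epsilon>" if "\<epsilon> > 0" for \<epsilon>
  proof -
    have "\<epsilon> / N > 0"
      using that N by simp
    then obtain \<delta> where \<delta>: "\<delta> > 0" "\<And>u. u \<in> lp p \<Longrightarrow> 0 < lp_norm p u \<Longrightarrow> lp_norm p u < \<delta> \<Longrightarrow>
        q u \<in> lp p \<and> lp_norm p (q u) < \<epsilon> / N"
      using lim unfolding limitin_lp_atin_zero[OF p] by blast
    show ?thesis
      unfolding eventually_at
    proof (intro exI conjI ballI impI)
      show "\<delta> / N > 0"
        using \<delta>(1) N by simp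
      fix t :: real assume t: "t \<noteq> 0 \<and> dist t 0 < \<delta> / N"
      define u where "u = (\<lambda>k. t * v k)"
      define e where "e = (\<lambda>n. (G (z + u) n - G z n) / t) - D v"
      have nu: "lp_norm p u = \<bar>t\<bar> * N" and u: "u \<in> lp p"
        using lp_scale[OF p v(1)] by (simp_all add: u_def N_def)
      have q: "q u \<in> lp p" "lp_norm p (q u) < \<epsilon> / N"
        using \<delta>(2)[OF u] t N by (auto simp: nu field_simps)
      have "\<bar>e n\<bar> \<le> N * \<bar>q u n\<bar>" for n
      proof -
        have "e n = (G (z + u) n - G z n - D u n) / t"
          using t Dt[of t] by (simp add: e_def u_def field_simps)
        then show ?thesis
          using t N by (simp add: q_def nu abs_mult)
      qed
      note e = lp_dominated[OF p q(1) this less_imp_le[OF N]]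
      have "N * lp_norm p (q u) < \<epsilon>"
        using q(2) N by (simp add: field_simps)
      then show "lp_norm p ((\<lambda>n. (G (z + (\<lambda>k. t * v k)) n - G z n) / t) - D v) < \<epsilon>"
        using e(2) unfolding e_def u_def by (rule le_less_trans[rotated])
      have "e + D v \<in> lp p"
        using lp_minkowski(1)[OF p e(1) Dv] .
      then show "(\<lambda>n. (G (z + (\<lambda>k. t * v k)) n - G z n) / t) \<in> lp p"
        unfolding e_def u_def diff_add_cancel .
    qed
  qed
  then show ?thesis
    unfolding has_gateaux_derivative_def limitin_lp[OF p] using Dv by blast
qed

lemma frechet_imp_gateaux_differentiable:
  assumes "1 \<le> p" "has_frechet_derivative p G z D"
  shows "gateaux_differentiable p G z"
  unfolding gateaux_differentiable_def using frechet_imp_gateaux[OF assms] by blast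

text \<open>
  The function chosen by \<^const>\<open>lp_frechet_derivative\<close> is itself a Frechet derivative, so
  in every direction both it and \<open>D\<close> give the unique Gateaux derivative.
\<close>

lemma lp_frechet_derivative_eq:
  assumes p: "1 \<le> p" and D: "has_frechet_derivative p G z D" and v: "v \<in> lp p" "v \<noteq> 0"
  shows "lp_frechet_derivative p G z v = D v"
proof -
  have "has_frechet_derivative p G z (lp_frechet_derivative p G z)"
    unfolding lp_frechet_derivative_def by (rule someI[of _ D]) (rule D)
  from gateaux_derivative_eq[OF p frechet_imp_gateaux[OF p this v]]
    gateaux_derivative_eq[OF p frechet_imp_gateaux[OF p D v]]
  show ?thesis
    by simp
qed

section \<open>Superposition operators\<close>

lemma lp_continuous_linear_multiplication:
  assumes p: "1 \<le> p" and c: "\<And>n. \<bar>c n\<bar> \<le> K"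
  shows "lp_continuous_linear p (\<lambda>u n. c n * u n)"
proof -
  have K: "0 \<le> K"
    using c[of 0] by simp
  have le: "\<bar>c n * u n\<bar> \<le> K * \<bar>u n\<bar>" for u n
    by (simp add: abs_mult c mult_right_mono)
  have "continuous_map (lp_topology p) (lp_topology p) (\<lambda>u n. c n * u n)"
    unfolding lp_topology_def
      Metric_space.metric_continuous_map[OF Metric_space_lp[OF p] Metric_space_lp[OF p]]
  proof (intro conjI ballI allI impI)
    show "(\<lambda>u n. c n * u n) ` lp p \<subseteq> lp p"
      by (intro image_subsetI lp_dominated(1)[OF p _ le K])
    fix a and \<epsilon> :: real assume a: "a \<in> lp p" and \<epsilon>: "\<epsilon> > 0"
    show "\<exists>\<delta>>0. \<forall>x. x \<in> lp p \<and> lp_dist p a x < \<delta> \<longrightarrow>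
        lp_dist p (\<lambda>n. c n * a n) (\<lambda>n. c n * x n) < \<epsilon>"
    proof (intro exI[of _ "\<epsilon> / (K + 1)"] conjI allI impI)
      show "\<epsilon> / (K + 1) > 0"
        using \<epsilon> K by simp
      fix x assume x: "x \<in> lp p \<and> lp_dist p a x < \<epsilon> / (K + 1)"
      have "lp_dist p (\<lambda>n. c n * a n) (\<lambda>n. c n * x n) = lp_norm p (\<lambda>n. c n * (a - x) n)"
        by (simp add: lp_dist_def fun_diff_def right_diff_distrib)
      also have "\<dots> \<le> K * lp_dist p a x"
        unfolding lp_dist_def using x
        by (intro lp_dominated(2)[OF p _ le K] lp_diff[OF p a]) simp
      also have "\<dots> \<le> (K + 1) * lp_dist p a x"
        by (simp add: lp_dist_def lp_norm_nonneg mult_right_mono)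
      also have "\<dots> < \<epsilon>"
        using x K by (simp add: field_simps)
      finally show "lp_dist p (\<lambda>n. c n * a n) (\<lambda>n. c n * x n) < \<epsilon>" .
    qed
  qed
  then show ?thesis
    by (simp add: lp_continuous_linear_def fun_eq_iff algebra_simps)
qed

text \<open>
  Because \<open>C\<close> does not depend on \<open>n\<close>, the remainder of an increment \<open>u\<close> is dominated by
  \<open>C \<parallel>u\<parallel> \<bar>u\<bar>\<close>, hence is of order \<open>\<parallel>u\<parallel>\<^sup>2\<close> in norm. A remainder bound for \<open>\<bar>h\<bar> \<le> 1\<close> suffices:
  an increment of norm at most \<open>1\<close> has coordinates of modulus at most \<open>1\<close>.
\<close>

lemma superposition_has_frechet_derivative:
  assumes p: "1 \<le> p" and c: "\<And>n. \<bar>c n\<bar> \<le> K"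
    and rem: "\<And>n h. \<bar>h\<bar> \<le> 1 \<Longrightarrow> \<bar>g n (z n + h) - g n (z n) - c n * h\<bar> \<le> C * h\<^sup>2"
  shows "has_frechet_derivative p (\<lambda>x n. g n (x n)) z (\<lambda>u n. c n * u n)"
proof -
  have C: "0 \<le> C"
    using rem[of 1 0] by simp
  define q where "q u = (\<lambda>n. (g n ((z + u) n) - g n (z n) - c n * u n) / lp_norm p u)" for u
  have "\<exists>\<delta>>0. \<forall>u \<in> lp p. 0 < lp_norm p u \<and> lp_norm p u < \<delta> \<longrightarrow>
      q u \<in> lp p \<and> lp_norm p (q u) < \<epsilon>" if \<epsilon>: "\<epsilon> > 0" for \<epsilon>
  proof (intro exI[of _ "min 1 (\<epsilon> / (C + 1))"] conjI ballI impI; (elim conjE)?)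
    show "min 1 (\<epsilon> / (C + 1)) > 0"
      using \<epsilon> C by simp
    fix u assume u: "u \<in> lp p" and pos: "0 < lp_norm p u" and lt: "lp_norm p u < min 1 (\<epsilon> / (C + 1))"
    have le: "\<bar>q u n\<bar> \<le> C * \<bar>u n\<bar>" for n
    proof -
      have un: "\<bar>u n\<bar> \<le> lp_norm p u"
        by (rule lp_coord_le_norm[OF p u])
      have "\<bar>g n ((z + u) n) - g n (z n) - c n * u n\<bar> \<le> C * (u n)\<^sup>2"
        using rem[of "u n" n] un lt by simp
      also have "(u n)\<^sup>2 = \<bar>u n\<bar> * \<bar>u n\<bar>"
        by (simp add: power2_eq_square)
      also have "C * (\<bar>u n\<bar> * \<bar>u n\<bar>) \<le> C * (\<bar>u n\<bar> * lp_norm p u)"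
        using un C by (intro mult_left_mono) auto
      finally show ?thesis
        using pos by (simp add: q_def divide_simps mult.assoc)
    qed
    show "q u \<in> lp p"
      by (rule lp_dominated(1)[OF p u le C])
    have "lp_norm p (q u) \<le> C * lp_norm p u"
      by (rule lp_dominated(2)[OF p u le C])
    also have "\<dots> \<le> (C + 1) * lp_norm p u"
      using pos by simp
    also have "\<dots> < \<epsilon>"
      using lt C by (simp add: field_simps)
    finally show "lp_norm p (q u) < \<epsilon>" .
  qed
  then show ?thesis
    unfolding has_frechet_derivative_def limitin_lp_atin_zero[OF p]
    using lp_continuous_linear_multiplication[OF p c] by (simp add: q_def)
qed

section \<open>Uniform Taylor remainders of a polynomial\<close>

text \<open>
  Writing \<open>r\<^sub>i\<close> for the remainder of the \<open>i\<close>-th power, \<open>r\<^sub>i\<^sub>+\<^sub>1 = (w + k) r\<^sub>i + i w\<^sup>i\<^sup>-\<^sup>1 k\<^sup>2\<close>, so the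
  quadratic bound passes from \<open>i\<close> to \<open>i + 1\<close> on a bounded interval.
\<close>

lemma power_remainder:
  fixes R :: real
  shows "\<exists>C\<ge>0. \<forall>w k. \<bar>w\<bar> \<le> R \<longrightarrow> \<bar>k\<bar> \<le> R \<longrightarrow>
    \<bar>(w + k) ^ i - w ^ i - real i * w ^ (i - 1) * k\<bar> \<le> C * k\<^sup>2"
proof (induction i)
  case 0
  show ?case by (auto intro!: exI[of _ 0])
next
  case (Suc i)
  then obtain C where C: "C \<ge> 0" "\<And>w k. \<bar>w\<bar> \<le> R \<Longrightarrow> \<bar>k\<bar> \<le> R \<Longrightarrow>
      \<bar>(w + k) ^ i - w ^ i - real i * w ^ (i - 1) * k\<bar> \<le> C * k\<^sup>2"
    by blast
  let ?C = "2 * \<bar>R\<bar> * C + real i * \<bar>R\<bar> ^ (i - 1)"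
  have "\<bar>(w + k) ^ Suc i - w ^ Suc i - real (Suc i) * w ^ (Suc i - 1) * k\<bar> \<le> ?C * k\<^sup>2"
    if w: "\<bar>w\<bar> \<le> R" and k: "\<bar>k\<bar> \<le> R" for w k
  proof -
    let ?r = "(w + k) ^ i - w ^ i - real i * w ^ (i - 1) * k"
    have "(w + k) ^ Suc i - w ^ Suc i - real (Suc i) * w ^ (Suc i - 1) * k
        = (w + k) * ?r + real i * w ^ (i - 1) * k\<^sup>2"
      by (cases i) (simp_all add: algebra_simps power2_eq_square)
    also have "\<bar>\<dots>\<bar> \<le> \<bar>w + k\<bar> * \<bar>?r\<bar> + real i * \<bar>w\<bar> ^ (i - 1) * k\<^sup>2"
      by (rule order_trans[OF abs_triangle_ineq]) (simp add: abs_mult power_abs)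
    also have "\<dots> \<le> (2 * \<bar>R\<bar>) * (C * k\<^sup>2) + real i * \<bar>R\<bar> ^ (i - 1) * k\<^sup>2"
      using w k C(1) C(2)[OF w k]
      by (intro add_mono mult_mono mult_left_mono mult_right_mono power_mono) auto
    finally show ?thesis
      by (simp add: algebra_simps)
  qed
  then show ?case
    using C(1) by (intro exI[of _ ?C]) auto
qed

lemma power_sum_remainder:
  fixes R :: real and a :: "nat \<Rightarrow> real"
  shows "\<exists>C\<ge>0. \<forall>w k. \<bar>w\<bar> \<le> R \<longrightarrow> \<bar>k\<bar> \<le> R \<longrightarrow>
    \<bar>(\<Sum>i\<in>I. a i * (w + k) ^ i) - (\<Sum>i\<in>I. a i * w ^ i)
      - (\<Sum>i\<in>I. real i * a i * w ^ (i - 1)) * k\<bar> \<le> C * k\<^sup>2"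
proof -
  obtain C where C: "\<And>i. C i \<ge> 0" "\<And>i w k. \<bar>w\<bar> \<le> R \<Longrightarrow> \<bar>k\<bar> \<le> R \<Longrightarrow>
      \<bar>(w + k) ^ i - w ^ i - real i * w ^ (i - 1) * k\<bar> \<le> C i * k\<^sup>2"
    using power_remainder[of R] by metis
  have "\<bar>(\<Sum>i\<in>I. a i * (w + k) ^ i) - (\<Sum>i\<in>I. a i * w ^ i)
      - (\<Sum>i\<in>I. real i * a i * w ^ (i - 1)) * k\<bar> \<le> (\<Sum>i\<in>I. \<bar>a i\<bar> * C i) * k\<^sup>2"
    if w: "\<bar>w\<bar> \<le> R" and k: "\<bar>k\<bar> \<le> R" for w k
  proof -
    have "(\<Sum>i\<in>I. a i * (w + k) ^ i) - (\<Sum>i\<in>I. a i * w ^ i)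
        - (\<Sum>i\<in>I. real i * a i * w ^ (i - 1)) * k
        = (\<Sum>i\<in>I. a i * ((w + k) ^ i - w ^ i - real i * w ^ (i - 1) * k))"
      by (simp only: sum_distrib_right sum_subtractf right_diff_distrib mult.assoc mult.left_commute)
    also have "\<bar>\<dots>\<bar> \<le> (\<Sum>i\<in>I. \<bar>a i\<bar> * (C i * k\<^sup>2))"
      using C(2)[OF w k]
      by (intro order_trans[OF sum_abs] sum_mono) (simp add: abs_mult mult_left_mono)
    finally show ?thesis
      by (simp add: sum_distrib_right mult.assoc)
  qed
  then show ?thesis
    using C(1) by (intro exI[of _ "\<Sum>i\<in>I. \<bar>a i\<bar> * C i"]) (auto intro!: sum_nonneg)
qed

lemma power_sum_bound:
  fixes R :: real and b :: "nat \<Rightarrow> real" and e :: "nat \<Rightarrow> nat"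
  assumes "\<bar>w\<bar> \<le> R"
  shows "\<bar>\<Sum>i\<in>I. b i * w ^ e i\<bar> \<le> (\<Sum>i\<in>I. \<bar>b i\<bar> * R ^ e i)"
  using assms
  by (intro order_trans[OF sum_abs] sum_mono) (simp add: abs_mult power_abs mult_left_mono power_mono)

section \<open>The polynomial operator\<close>

lemma square_plus_in_lp:
  assumes p: "1 \<le> p" and x: "x \<in> lp p" and y: "y \<in> lp p"
  shows "(\<lambda>n. (x n)\<^sup>2 + y n) \<in> lp p"
proof -
  have "\<bar>(x n)\<^sup>2\<bar> \<le> lp_norm p x * \<bar>x n\<bar>" for n
    using mult_right_mono[OF lp_coord_le_norm[OF p x, of n], of "\<bar>x n\<bar>"]
    by (simp add: power2_eq_square)
  then have "(\<lambda>n. (x n)\<^sup>2) \<in> lp p"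
    by (rule lp_dominated(1)[OF p x]) (rule lp_norm_nonneg)
  from lp_minkowski(1)[OF p this y] show ?thesis
    by (simp add: plus_fun_def)
qed

lemma Q_in_lp:
  assumes p: "1 \<le> p" and x: "x \<in> lp p" and y: "y \<in> lp p"
  shows "Q m a x y \<in> lp p"
proof -
  define w where "w n = (x n)\<^sup>2 + y n" for n
  have w: "w \<in> lp p"
    using square_plus_in_lp[OF p x y] by (simp add: w_def[abs_def])
  define K where "K = (\<Sum>i=1..m. \<bar>a i\<bar> * lp_norm p w ^ (i - 1))"
  have "\<bar>Q m a x y n\<bar> \<le> K * \<bar>w n\<bar>" for n
  proof -
    \<comment> \<open>There is no constant term, so a factor \<open>w n\<close> splits off.\<close>
    have "w n ^ i = w n ^ (i - 1) * w n" if "i \<in> {1..m}" for i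
      using that by (cases i) auto
    then have "Q m a x y n = (\<Sum>i=1..m. a i * w n ^ (i - 1)) * w n"
      unfolding Q_def w_def[symmetric] sum_distrib_right by (intro sum.cong) auto
    then show ?thesis
      using power_sum_bound[OF lp_coord_le_norm[OF p w], where I = "{1..m}" and b = a and e = "\<lambda>i. i - 1"]
      by (simp add: K_def abs_mult mult_right_mono)
  qed
  then show ?thesis
    by (rule lp_dominated(1)[OF p w]) (simp add: K_def sum_nonneg lp_norm_nonneg)
qed

text \<open>
  With \<open>w = x\<^sub>n\<^sup>2 + y\<^sub>n\<close>, an increment \<open>h\<close> of \<open>x\<^sub>n\<close> moves \<open>w\<close> by \<open>k = 2 x\<^sub>n h + h\<^sup>2\<close>; the Taylor
  remainder of the polynomial contributes \<open>C k\<^sup>2\<close> and the second-order part of \<open>k\<close> contributes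
  \<open>P'(w) h\<^sup>2\<close>, both of order \<open>h\<^sup>2\<close> uniformly in \<open>n\<close>.
\<close>

lemma Q_has_frechet_derivative_1:
  assumes p: "1 \<le> p" and x: "x \<in> lp p" and y: "y \<in> lp p"
  shows "has_frechet_derivative p (\<lambda>z. Q m a z y) x
    (\<lambda>v n. 2 * (\<Sum>i=1..m. a i * real i * x n * ((x n)\<^sup>2 + y n) ^ (i - 1) * v n))"
proof -
  define P P' where "P w = (\<Sum>i=1..m. a i * w ^ i)"
    and "P' w = (\<Sum>i=1..m. real i * a i * w ^ (i - 1))" for w
  define M N where "M = lp_norm p x" and "N = lp_norm p y"
  have M: "\<bar>x n\<bar> \<le> M" and N: "\<bar>y n\<bar> \<le> N" for n
    by (simp_all add: M_def N_def lp_coord_le_norm p x y)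
  have M0: "0 \<le> M" and N0: "0 \<le> N"
    by (simp_all add: M_def N_def lp_norm_nonneg)
  \<comment> \<open>This radius bounds both \<open>w\<close> and \<open>k\<close>.\<close>
  define R where "R = (M + 1)\<^sup>2 + N"
  have sq: "(x n)\<^sup>2 \<le> M\<^sup>2" for n
    using M[of n] power_mono[of "\<bar>x n\<bar>" M 2] by simp
  have w: "\<bar>(x n)\<^sup>2 + y n\<bar> \<le> R" for n
    using sq[of n] N[of n] M0 zero_le_power2[of "x n"] one_power2[where 'a = real]
    unfolding R_def power2_sum mult_1_right by linarith
  obtain C where C: "C \<ge> 0" "\<And>w k. \<bar>w\<bar> \<le> R \<Longrightarrow> \<bar>k\<bar> \<le> R \<Longrightarrow>
      \<bar>P (w + k) - P w - P' w * k\<bar> \<le> C * k\<^sup>2"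
    using power_sum_remainder[where R = R and I = "{1..m}" and a = a] unfolding P_def P'_def by blast
  define K where "K = (\<Sum>i=1..m. \<bar>real i * a i\<bar> * R ^ (i - 1))"
  have K: "\<bar>P' ((x n)\<^sup>2 + y n)\<bar> \<le> K" for n
    unfolding P'_def K_def by (rule power_sum_bound[OF w])
  define c where "c n = 2 * x n * P' ((x n)\<^sup>2 + y n)" for n
  have "has_frechet_derivative p (\<lambda>z n. P ((z n)\<^sup>2 + y n)) x (\<lambda>u n. c n * u n)"
  proof (rule superposition_has_frechet_derivative[OF p,
        where g = "\<lambda>n s. P (s\<^sup>2 + y n)" and C = "C * (2 * M + 1)\<^sup>2 + K"])
    show "\<bar>c n\<bar> \<le> 2 * M * K" for n
      using mult_mono[OF M[of n] K[of n]] M0 by (simp add: c_def abs_mult)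
    fix n and h :: real assume h: "\<bar>h\<bar> \<le> 1"
    let ?w = "(x n)\<^sup>2 + y n" and ?k = "(2 * x n + h) * h"
    have f: "\<bar>2 * x n + h\<bar> \<le> 2 * M + 1"
      using M[of n] h by linarith
    have "\<bar>?k\<bar> \<le> (2 * M + 1) * \<bar>h\<bar>"
      using f by (simp add: abs_mult mult_right_mono)
    also have "\<dots> \<le> (2 * M + 1) * 1"
      using h M0 by (intro mult_left_mono) auto
    also have "\<dots> \<le> R"
      using N0 by (simp add: R_def power2_sum)
    finally have kR: "\<bar>?k\<bar> \<le> R" .
    have k2: "?k\<^sup>2 \<le> (2 * M + 1)\<^sup>2 * h\<^sup>2"
      using power_mono[OF f, of 2] by (simp add: power_mult_distrib mult_right_mono)
    have "(x n + h)\<^sup>2 + y n = ?w + ?k"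
      by (simp add: power2_eq_square algebra_simps)
    then have "P ((x n + h)\<^sup>2 + y n) - P ?w - c n * h = (P (?w + ?k) - P ?w - P' ?w * ?k) + P' ?w * h\<^sup>2"
      by (simp add: c_def power2_eq_square algebra_simps)
    also have "\<bar>\<dots>\<bar> \<le> C * ?k\<^sup>2 + K * h\<^sup>2"
      by (rule order_trans[OF abs_triangle_ineq])
        (intro add_mono C(2) w kR, simp add: abs_mult mult_right_mono K)
    also have "\<dots> \<le> C * ((2 * M + 1)\<^sup>2 * h\<^sup>2) + K * h\<^sup>2"
      using k2 C(1) by (intro add_right_mono mult_left_mono)
    finally show "\<bar>P ((x n + h)\<^sup>2 + y n) - P ?w - c n * h\<bar> \<le> (C * (2 * M + 1)\<^sup>2 + K) * h\<^sup>2"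
      by (simp add: algebra_simps)
  qed
  moreover have "(\<lambda>u n. c n * u n) =
      (\<lambda>v n. 2 * (\<Sum>i=1..m. a i * real i * x n * ((x n)\<^sup>2 + y n) ^ (i - 1) * v n))"
    by (simp add: c_def P'_def fun_eq_iff sum_distrib_left sum_distrib_right mult_ac)
  ultimately show ?thesis
    by (simp add: Q_def P_def)
qed

lemma Q_has_frechet_derivative_2:
  assumes p: "1 \<le> p" and x: "x \<in> lp p" and y: "y \<in> lp p"
  shows "has_frechet_derivative p (\<lambda>z. Q m a x z) y
    (\<lambda>u n. \<Sum>i=1..m. real i * a i * ((x n)\<^sup>2 + y n) ^ (i - 1) * u n)"
proof -
  define P P' where "P w = (\<Sum>i=1..m. a i * w ^ i)"
    and "P' w = (\<Sum>i=1..m. real i * a i * w ^ (i - 1))" for w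
  define R where "R = lp_norm p (\<lambda>n. (x n)\<^sup>2 + y n) + 1"
  have w: "\<bar>(x n)\<^sup>2 + y n\<bar> \<le> R" for n
    using lp_coord_le_norm[OF p square_plus_in_lp[OF p x y], of n] by (simp add: R_def)
  have R1: "1 \<le> R"
    by (simp add: R_def lp_norm_nonneg)
  obtain C where C: "\<And>w k. \<bar>w\<bar> \<le> R \<Longrightarrow> \<bar>k\<bar> \<le> R \<Longrightarrow>
      \<bar>P (w + k) - P w - P' w * k\<bar> \<le> C * k\<^sup>2"
    using power_sum_remainder[where R = R and I = "{1..m}" and a = a] unfolding P_def P'_def by blast
  have "has_frechet_derivative p (\<lambda>z n. P ((x n)\<^sup>2 + z n)) y (\<lambda>u n. P' ((x n)\<^sup>2 + y n) * u n)"
  proof (rule superposition_has_frechet_derivative[OF p, where g = "\<lambda>n s. P ((x n)\<^sup>2 + s)"])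
    show "\<bar>P' ((x n)\<^sup>2 + y n)\<bar> \<le> (\<Sum>i=1..m. \<bar>real i * a i\<bar> * R ^ (i - 1))" for n
      unfolding P'_def by (rule power_sum_bound[OF w])
    show "\<bar>P ((x n)\<^sup>2 + (y n + h)) - P ((x n)\<^sup>2 + y n) - P' ((x n)\<^sup>2 + y n) * h\<bar> \<le> C * h\<^sup>2"
      if "\<bar>h\<bar> \<le> 1" for n h
      using C[OF w[of n], of h] that R1 by (simp add: add.assoc)
  qed
  then show ?thesis
    by (simp add: Q_def P_def P'_def sum_distrib_right)
qed

text \<open>Everything the theorem asserts about a partial derivative follows from exhibiting it.\<close>

lemma frechet_derivative_consequences:
  assumes p: "1 \<le> p" and D: "has_frechet_derivative p G z D"
  shows "gateaux_differentiable p G z"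
    and "frechet_differentiable p G z"
    and "v \<in> lp p - {0} \<Longrightarrow> gateaux_derivative p G z v = lp_frechet_derivative p G z v"
    and "v \<in> lp p - {0} \<Longrightarrow> lp_frechet_derivative p G z v = D v"
    and "v \<in> lp p - {0} \<Longrightarrow> D v \<in> lp p"
proof -
  show "gateaux_differentiable p G z"
    by (rule frechet_imp_gateaux_differentiable[OF p D])
  show "frechet_differentiable p G z"
    using D unfolding frechet_differentiable_def by (rule exI[of _ D])
  assume "v \<in> lp p - {0}"
  then have v: "v \<in> lp p" "v \<noteq> 0"
    by auto
  note gateaux = frechet_imp_gateaux[OF p D v]
  show frechet: "lp_frechet_derivative p G z v = D v"
    by (rule lp_frechet_derivative_eq[OF p D v])
  show "gateaux_derivative p G z v = lp_frechet_derivative p G z v"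
    unfolding frechet by (rule gateaux_derivative_eq[OF p gateaux])
  show "D v \<in> lp p"
    using gateaux unfolding has_gateaux_derivative_def limitin_lp[OF p] by blast
qed

theorem corollary3p4:
  fixes p :: real and m :: nat and a :: "nat \<Rightarrow> real"
  assumes "1 < p" and "m \<ge> 1"
  shows "(\<forall>x \<in> lp p. \<forall>y \<in> lp p. Q m a x y \<in> lp p) \<and>
    (\<forall>x \<in> lp p. \<forall>y \<in> lp p.
       partial1_gateaux_differentiable p (Q m a) x y \<and>
       partial2_gateaux_differentiable p (Q m a) x y \<and>
       partial1_frechet_differentiable p (Q m a) x y \<and>
       partial2_frechet_differentiable p (Q m a) x y \<and>
       (\<forall>v \<in> lp p - {0}.
          partial1_gateaux p (Q m a) x y v = partial1_frechet p (Q m a) x y v \<and>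
          partial1_frechet p (Q m a) x y v =
            (\<lambda>n. 2 * (\<Sum>i=1..m. a i * real i * x n * ((x n)\<^sup>2 + y n) ^ (i - 1) * v n)) \<and>
          (\<lambda>n. 2 * (\<Sum>i=1..m. a i * real i * x n * ((x n)\<^sup>2 + y n) ^ (i - 1) * v n)) \<in> lp p) \<and>
       (\<forall>u \<in> lp p - {0}.
          partial2_gateaux p (Q m a) x y u = partial2_frechet p (Q m a) x y u \<and>
          partial2_frechet p (Q m a) x y u =
            (\<lambda>n. \<Sum>i=1..m. real i * a i * ((x n)\<^sup>2 + y n) ^ (i - 1) * u n) \<and>
          (\<lambda>n. \<Sum>i=1..m. real i * a i * ((x n)\<^sup>2 + y n) ^ (i - 1) * u n) \<in> lp p))"
proof -
  have p: "1 \<le> p"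
    using assms(1) by simp
  show ?thesis
    unfolding partial1_gateaux_differentiable_def partial2_gateaux_differentiable_def
      partial1_frechet_differentiable_def partial2_frechet_differentiable_def
      partial1_gateaux_def partial2_gateaux_def partial1_frechet_def partial2_frechet_def
    by (intro conjI ballI Q_in_lp[OF p]
        frechet_derivative_consequences[OF p Q_has_frechet_derivative_1[OF p]]
        frechet_derivative_consequences[OF p Q_has_frechet_derivative_2[OF p]])
qed

end
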